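(* Let $\mathscr{T}$ be a regular T-mesh with $V^+$ crossing vertices. Then $$\dim \overline{\mathbf{S}}(1,1,0,0,\mathscr{T})=V^+.$$
   Context: A T-mesh is a rectangular grid that allows T-junctions: a region is subdivided by finitely many horizontal and vertical segments into finitely many closed axis-parallel rectangles (the cells) with pairwise disjoint interiors. It is regular if the region $\Omega$ occupied by all its cells is a rectangle. Vertices are the grid points (corners of cells); a vertex on $\partial\Omega$ is a boundary vertex, and an interior vertex is a crossing vertex if four edges meet there and a T-vertex if exactly three edges meet there. Let $\mathscr{F}$ be the set of cells and $\mathbb{P}_{mn}$ the polynomials in $(x,y)$ of bi-degree $(m,n)$ (degree at most $m$ in $x$ and at most $n$ in $y$). $C^{\alpha,\beta}$ denotes functions that are continuous with order $\alpha$ in the $x$ direction and order $\beta$ in the $y$ direction. The spline space with homogeneous boundary conditions is $$\overline{\mathbf{S}}(m,n,\alpha,\beta,\mathscr{T})=\{f\in C^{\alpha,\beta}(\mathbb{R}^2): f|_{\phi}\in\mathbb{P}_{mn}\ \forall\phi\in\mathscr{F},\ f|_{\mathbb{R}^2\setminus\Omega}\equiv 0\}.$$ Thus $\overline{\mathbf{S}}(1,1,0,0,\mathscr{T})$ consists of the continuous functions on $\mathbb{R}^2$ that are bilinear on each cell and vanish outside $\Omega$. *)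

theory Defs
  imports "HOL-Analysis.Analysis" "HOL-Library.Function_Algebras"
begin

text \<open>
  Real vector spaces of functions: \<^theory>\<open>HOL-Library.Function_Algebras\<close> supplies the pointwise
  additive group; adding the pointwise scalar multiplication makes the library's \<open>subspace\<close>,
  \<open>span\<close> and \<open>dim\<close> available for sets of functions.
\<close>

instantiation "fun" :: (type, real_vector) real_vector
begin

definition scaleR_fun :: "real \<Rightarrow> ('a \<Rightarrow> 'b) \<Rightarrow> 'a \<Rightarrow> 'b"
  where "scaleR_fun c f = (\<lambda>x. c *\<^sub>R f x)"

instance
  by standard (simp_all add: scaleR_fun_def plus_fun_def scaleR_add_right scaleR_add_left)

end

subsection \<open>T-meshes\<close>

text \<open>A T-mesh is represented by its set of cells.\<close>

type_synonym mesh = "(real \<times> real) set set"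

definition rectangle :: "(real \<times> real) set \<Rightarrow> bool"
  where "rectangle R \<longleftrightarrow> (\<exists>a b c d. a < b \<and> c < d \<and> R = {a..b} \<times> {c..d})"

definition rectangle_corners :: "(real \<times> real) set \<Rightarrow> (real \<times> real) set"
  where "rectangle_corners R =
    {p. \<exists>a b c d. a < b \<and> c < d \<and> R = {a..b} \<times> {c..d} \<and> p \<in> {a, b} \<times> {c, d}}"

definition T_mesh :: "mesh \<Rightarrow> bool"
  where "T_mesh F \<longleftrightarrow>
    finite F \<and> (\<forall>\<phi>\<in>F. rectangle \<phi>) \<and>
    pairwise (\<lambda>\<phi> \<psi>. interior \<phi> \<inter> interior \<psi> = {}) F"

definition mesh_region :: "mesh \<Rightarrow> (real \<times> real) set"
  where "mesh_region F = \<Union>F"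

definition regular_T_mesh :: "mesh \<Rightarrow> bool"
  where "regular_T_mesh F \<longleftrightarrow> T_mesh F \<and> rectangle (mesh_region F)"

definition mesh_vertices :: "mesh \<Rightarrow> (real \<times> real) set"
  where "mesh_vertices F = (\<Union>\<phi>\<in>F. rectangle_corners \<phi>)"

text \<open>
  The union of the cell boundaries is the set of all points on the segments subdividing the
  region.  An edge is a horizontal or vertical piece of it joining two consecutive vertices, so
  a side of a cell is split into several edges by the T-junctions lying on it.
\<close>

definition mesh_edges :: "mesh \<Rightarrow> (real \<times> real) set set"
  where "mesh_edges F =
    {closed_segment v w | v w.
       v \<in> mesh_vertices F \<and> w \<in> mesh_vertices F \<and> v \<noteq> w \<and>
       (fst v = fst w \<or> snd v = snd w) \<and>
       closed_segment v w \<subseteq> (\<Union>\<phi>\<in>F. frontier \<phi>) \<and>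
       open_segment v w \<inter> mesh_vertices F = {}}"

definition interior_vertices :: "mesh \<Rightarrow> (real \<times> real) set"
  where "interior_vertices F = mesh_vertices F - frontier (mesh_region F)"

text \<open>Edges contain no vertices besides their endpoints, so \<open>v \<in> e\<close> says that \<open>e\<close> ends at \<open>v\<close>.\<close>

definition crossing_vertices :: "mesh \<Rightarrow> (real \<times> real) set"
  where "crossing_vertices F =
    {v \<in> interior_vertices F. card {e \<in> mesh_edges F. v \<in> e} = 4}"

subsection \<open>Spline spaces\<close>

text \<open>
  \<open>D i j\<close> is the mixed partial derivative of \<open>D 0 0\<close>, \<open>i\<close> times in \<open>x\<close> and \<open>j\<close> times in \<open>y\<close>;
  all of these up to order \<open>\<alpha>\<close> in \<open>x\<close> and \<open>\<beta>\<close> in \<open>y\<close> are required to exist and be continuous.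
\<close>

definition continuous_partials ::
    "nat \<Rightarrow> nat \<Rightarrow> (nat \<Rightarrow> nat \<Rightarrow> real \<times> real \<Rightarrow> real) \<Rightarrow> bool"
  where "continuous_partials \<alpha> \<beta> D \<longleftrightarrow>
    (\<forall>i\<le>\<alpha>. \<forall>j\<le>\<beta>. continuous_on UNIV (D i j)) \<and>
    (\<forall>i<\<alpha>. \<forall>j\<le>\<beta>. \<forall>x y.
       ((\<lambda>t. D i j (t, y)) has_real_derivative D (Suc i) j (x, y)) (at x)) \<and>
    (\<forall>i\<le>\<alpha>. \<forall>j<\<beta>. \<forall>x y.
       ((\<lambda>t. D i j (x, t)) has_real_derivative D i (Suc j) (x, y)) (at y))"

definition C_order :: "nat \<Rightarrow> nat \<Rightarrow> (real \<times> real \<Rightarrow> real) set"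
  where "C_order \<alpha> \<beta> = {f. \<exists>D. continuous_partials \<alpha> \<beta> D \<and> D 0 0 = f}"

definition bidegree_poly_on ::
    "nat \<Rightarrow> nat \<Rightarrow> (real \<times> real) set \<Rightarrow> (real \<times> real \<Rightarrow> real) \<Rightarrow> bool"
  where "bidegree_poly_on m n S f \<longleftrightarrow>
    (\<exists>c. \<forall>x y. (x, y) \<in> S \<longrightarrow> f (x, y) = (\<Sum>i\<le>m. \<Sum>j\<le>n. c i j * x ^ i * y ^ j))"

definition hom_spline_space ::
    "nat \<Rightarrow> nat \<Rightarrow> nat \<Rightarrow> nat \<Rightarrow> mesh \<Rightarrow> (real \<times> real \<Rightarrow> real) set"
  where "hom_spline_space m n \<alpha> \<beta> F =
    {f \<in> C_order \<alpha> \<beta>.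
       (\<forall>\<phi>\<in>F. bidegree_poly_on m n \<phi> f) \<and> (\<forall>p. p \<notin> mesh_region F \<longrightarrow> f p = 0)}"

lemma C_order_0_0: "C_order 0 0 = {f. continuous_on UNIV f}"
proof -
  have "continuous_partials 0 0 (\<lambda>_ _. f)" if "continuous_on UNIV f" for f
    using that by (simp add: continuous_partials_def)
  then show ?thesis
    by (auto simp: C_order_def continuous_partials_def)
qed

lemma subspace_C_order: "subspace (C_order \<alpha> \<beta>)"
proof (rule subspaceI)
  have "continuous_partials \<alpha> \<beta> (\<lambda>_ _ _. 0)"
    by (simp add: continuous_partials_def)
  then show "0 \<in> C_order \<alpha> \<beta>"
    unfolding C_order_def zero_fun_def by blast
next
  fix f g assume "f \<in> C_order \<alpha> \<beta>" "g \<in> C_order \<alpha> \<beta>"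
  then obtain D E where D: "continuous_partials \<alpha> \<beta> D" "D 0 0 = f"
    and E: "continuous_partials \<alpha> \<beta> E" "E 0 0 = g"
    unfolding C_order_def by blast
  from D(1) E(1) have "continuous_partials \<alpha> \<beta> (\<lambda>i j p. D i j p + E i j p)"
    by (simp add: continuous_partials_def continuous_on_add DERIV_add)
  with D(2) E(2) show "f + g \<in> C_order \<alpha> \<beta>"
    unfolding C_order_def plus_fun_def by blast
next
  fix c f assume "f \<in> C_order \<alpha> \<beta>"
  then obtain D where D: "continuous_partials \<alpha> \<beta> D" "D 0 0 = f"
    unfolding C_order_def by blast
  from D(1) have "continuous_partials \<alpha> \<beta> (\<lambda>i j p. c *\<^sub>R D i j p)"
    by (simp add: continuous_partials_def continuous_on_mult_left DERIV_cmult)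
  with D(2) show "c *\<^sub>R f \<in> C_order \<alpha> \<beta>"
    unfolding C_order_def scaleR_fun_def by blast
qed

lemma subspace_bidegree_poly_on: "subspace {f. bidegree_poly_on m n S f}"
proof (rule subspaceI)
  show "0 \<in> {f. bidegree_poly_on m n S f}"
    unfolding bidegree_poly_on_def
    by (intro CollectI exI[of _ "\<lambda>_ _. 0"]) auto
next
  fix f g assume "f \<in> {f. bidegree_poly_on m n S f}" "g \<in> {f. bidegree_poly_on m n S f}"
  then obtain c d where
      "\<forall>x y. (x, y) \<in> S \<longrightarrow> f (x, y) = (\<Sum>i\<le>m. \<Sum>j\<le>n. c i j * x ^ i * y ^ j)"
      "\<forall>x y. (x, y) \<in> S \<longrightarrow> g (x, y) = (\<Sum>i\<le>m. \<Sum>j\<le>n. d i j * x ^ i * y ^ j)"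
    unfolding bidegree_poly_on_def by blast
  then show "f + g \<in> {f. bidegree_poly_on m n S f}"
    unfolding bidegree_poly_on_def
    by (intro CollectI exI[of _ "\<lambda>i j. c i j + d i j"])
      (auto simp: plus_fun_def sum.distrib distrib_right)
next
  fix a f assume "f \<in> {f. bidegree_poly_on m n S f}"
  then obtain c where "\<forall>x y. (x, y) \<in> S \<longrightarrow> f (x, y) = (\<Sum>i\<le>m. \<Sum>j\<le>n. c i j * x ^ i * y ^ j)"
    unfolding bidegree_poly_on_def by blast
  then show "a *\<^sub>R f \<in> {f. bidegree_poly_on m n S f}"
    unfolding bidegree_poly_on_def
    by (intro CollectI exI[of _ "\<lambda>i j. a * c i j"])
      (auto simp: scaleR_fun_def sum_distrib_left mult.assoc)
qed

lemma subspace_hom_spline_space: "subspace (hom_spline_space m n \<alpha> \<beta> F)"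
proof -
  have C: "0 \<in> C_order \<alpha> \<beta>"
      "f \<in> C_order \<alpha> \<beta> \<Longrightarrow> g \<in> C_order \<alpha> \<beta> \<Longrightarrow> f + g \<in> C_order \<alpha> \<beta>"
      "f \<in> C_order \<alpha> \<beta> \<Longrightarrow> a *\<^sub>R f \<in> C_order \<alpha> \<beta>" for f g a
    using subspace_C_order[of \<alpha> \<beta>] by (simp_all add: subspace_0 subspace_add subspace_scale)
  have P: "bidegree_poly_on m n S 0"
      "bidegree_poly_on m n S f \<Longrightarrow> bidegree_poly_on m n S g \<Longrightarrow> bidegree_poly_on m n S (f + g)"
      "bidegree_poly_on m n S f \<Longrightarrow> bidegree_poly_on m n S (a *\<^sub>R f)" for S f g a
    using subspace_bidegree_poly_on[of m n S] unfolding subspace_def by simp_all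
  show ?thesis
    by (rule subspaceI) (simp_all add: hom_spline_space_def C P plus_fun_apply zero_fun_apply,
      simp add: scaleR_fun_def)
qed

end

theory Submission
  imports Defs
begin

text \<open>
  A continuous function that is bilinear on each cell is determined by its values at the vertices,
  and these values are not independent.  An interior vertex is either a corner of all four cells
  around it, or it hangs: it lies inside a side of exactly one cell, and there the function,
  being affine on that side, interpolates linearly between the two ends of the side.  The vertices
  of the first kind are exactly the crossing vertices (\<open>crossing_iff\<close>); at a boundary vertex the
  function vanishes.  The theorem says that the values at the crossing vertices can be prescribed
  arbitrarily and determine everything else.
  
  They determine everything because of a discrete maximum principle (\<open>maximum_principle\<close>).  A
  function on the vertices that satisfies all interpolation conditions and vanishes at crossing and
  boundary vertices cannot have a positive maximum: at a hanging vertex the maximum would be shared by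
  both ends of the side, so it would move on to vertices with larger and larger coordinate sum.  The
  same holds for the negative.
  
  They can be prescribed because the conditions form a square linear system, one equation for each
  vertex, and the maximum principle makes it injective; in finite dimension it is then
  surjective (\<open>residual_onto\<close>).  For vertex values that satisfy all conditions, the bilinear
  interpolants on the cells agree where cells meet (\<open>interpolants_agree\<close>) and vanish on the boundary
  (\<open>interpolant_zero_on_boundary\<close>), so together they form a spline.
  
  Restriction to the crossing vertices is thus a linear bijection from the spline space onto the
  functions supported there.
\<close>

section \<open>Rectangles and their bounds\<close>

definition xmin :: "(real \<times> real) set \<Rightarrow> real" where "xmin R = Inf (fst ` R)"
definition xmax :: "(real \<times> real) set \<Rightarrow> real" where "xmax R = Sup (fst ` R)"
definition ymin :: "(real \<times> real) set \<Rightarrow> real" where "ymin R = Inf (snd ` R)"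
definition ymax :: "(real \<times> real) set \<Rightarrow> real" where "ymax R = Sup (snd ` R)"

lemma bounds_of_box:
  assumes "a < b" "c < d"
  shows "xmin ({a..b} \<times> {c..d}) = a" "xmax ({a..b} \<times> {c..d}) = b"
    "ymin ({a..b} \<times> {c..d}) = c" "ymax ({a..b} \<times> {c..d}) = d"
  using assms by (auto simp: xmin_def xmax_def ymin_def ymax_def fst_image_times snd_image_times)

lemma
  assumes "rectangle R"
  shows rectangle_xmin_less: "xmin R < xmax R"
    and rectangle_ymin_less: "ymin R < ymax R"
    and rectangle_eq_box: "R = {xmin R..xmax R} \<times> {ymin R..ymax R}"
proof -
  obtain a b c d where "a < b" "c < d" "R = {a..b} \<times> {c..d}"
    using assms unfolding rectangle_def by blast
  then show "xmin R < xmax R" "ymin R < ymax R" "R = {xmin R..xmax R} \<times> {ymin R..ymax R}"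
    by (simp_all add: bounds_of_box)
qed

lemma mem_rectangle:
  assumes "rectangle R"
  shows "p \<in> R \<longleftrightarrow> xmin R \<le> fst p \<and> fst p \<le> xmax R \<and> ymin R \<le> snd p \<and> snd p \<le> ymax R"
  by (subst rectangle_eq_box[OF assms]) (auto simp: mem_Times_iff)

lemma closed_rectangle: "rectangle R \<Longrightarrow> closed R"
  by (auto simp: rectangle_def intro: closed_Times)

lemma mem_interior_rectangle:
  assumes "rectangle R"
  shows "p \<in> interior R \<longleftrightarrow> xmin R < fst p \<and> fst p < xmax R \<and> ymin R < snd p \<and> snd p < ymax R"
  by (subst rectangle_eq_box[OF assms]) (auto simp: mem_Times_iff interior_Times)

lemma mem_frontier_rectangle:
  "rectangle R \<Longrightarrow> p \<in> frontier R \<longleftrightarrow> p \<in> R \<and> p \<notin> interior R"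
  by (simp add: frontier_def closed_rectangle)

lemma rectangle_corners_eq:
  assumes "rectangle R"
  shows "rectangle_corners R = {xmin R, xmax R} \<times> {ymin R, ymax R}"
proof -
  note ineq = rectangle_xmin_less[OF assms] rectangle_ymin_less[OF assms]
  note box = rectangle_eq_box[OF assms]
  have *: "a = xmin R \<and> b = xmax R \<and> c = ymin R \<and> d = ymax R"
    if "a < b" "c < d" "R = {a..b} \<times> {c..d}" for a b c d
    using that by (simp add: bounds_of_box)
  show ?thesis
  proof (intro set_eqI iffI)
    fix p assume "p \<in> rectangle_corners R"
    then obtain a b c d where "a < b" "c < d" "R = {a..b} \<times> {c..d}" "p \<in> {a, b} \<times> {c, d}"
      unfolding rectangle_corners_def by blast
    with * show "p \<in> {xmin R, xmax R} \<times> {ymin R, ymax R}" by metis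
  next
    fix p assume "p \<in> {xmin R, xmax R} \<times> {ymin R, ymax R}"
    with ineq box show "p \<in> rectangle_corners R"
      unfolding rectangle_corners_def by blast
  qed
qed

lemma mem_rectangle_corners:
  assumes "rectangle R"
  shows "p \<in> rectangle_corners R \<longleftrightarrow> (fst p = xmin R \<or> fst p = xmax R) \<and> (snd p = ymin R \<or> snd p = ymax R)"
  by (cases p) (auto simp: rectangle_corners_eq[OF assms])

lemma rectangle_corners_subset: "rectangle R \<Longrightarrow> rectangle_corners R \<subseteq> R"
  using rectangle_xmin_less[of R] rectangle_ymin_less[of R]
  by (auto simp: mem_rectangle_corners mem_rectangle)

text \<open>
  A vertex hangs on a cell if it lies on a side of the cell without being one of its corners:
  it is then a T-vertex (or a boundary vertex), and the values of a spline there are dictated by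
  the two ends of that side.
\<close>

definition hangs :: "real \<times> real \<Rightarrow> (real \<times> real) set \<Rightarrow> bool"
  where "hangs v R \<longleftrightarrow> v \<in> frontier R - rectangle_corners R"

lemma hangs_iff:
  assumes "rectangle R"
  shows "hangs v R \<longleftrightarrow>
    (fst v = xmin R \<or> fst v = xmax R) \<and> ymin R < snd v \<and> snd v < ymax R \<or>
    (snd v = ymin R \<or> snd v = ymax R) \<and> xmin R < fst v \<and> fst v < xmax R"
  using rectangle_xmin_less[OF assms] rectangle_ymin_less[OF assms]
  by (auto simp: hangs_def mem_frontier_rectangle mem_rectangle mem_interior_rectangle
      mem_rectangle_corners assms)

section \<open>Bilinear interpolation\<close>

text \<open>
  The bilinear function with the values of \<open>g\<close> at the four corners of \<open>R\<close>.  Only these four values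
  of \<open>g\<close> enter, so a function on the vertices is enough to determine it.
\<close>

definition interpolant :: "(real \<times> real) set \<Rightarrow> (real \<times> real \<Rightarrow> real) \<Rightarrow> real \<times> real \<Rightarrow> real"
  where "interpolant R g p =
   ((xmax R - fst p) * (ymax R - snd p) * g (xmin R, ymin R) +
    (fst p - xmin R) * (ymax R - snd p) * g (xmax R, ymin R) +
    (xmax R - fst p) * (snd p - ymin R) * g (xmin R, ymax R) +
    (fst p - xmin R) * (snd p - ymin R) * g (xmax R, ymax R)) /
   ((xmax R - xmin R) * (ymax R - ymin R))"

lemma interpolant_add: "interpolant R (f + g) p = interpolant R f p + interpolant R g p"
  unfolding interpolant_def add_divide_distrib[symmetric]
  by (rule arg_cong2[where f = "(/)"]) (auto simp: algebra_simps)

lemma interpolant_scaleR: "interpolant R (c *\<^sub>R f) p = c * interpolant R f p"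
  unfolding interpolant_def times_divide_eq_right
  by (rule arg_cong2[where f = "(/)"]) (auto simp: scaleR_fun_def algebra_simps)

lemma interpolant_cong:
  assumes "rectangle R" "\<And>q. q \<in> rectangle_corners R \<Longrightarrow> f q = g q"
  shows "interpolant R f p = interpolant R g p"
  using assms by (simp add: interpolant_def mem_rectangle_corners)

lemma interpolant_corner:
  assumes "rectangle R" "p \<in> rectangle_corners R"
  shows "interpolant R g p = g p"
  using assms rectangle_xmin_less[OF assms(1)] rectangle_ymin_less[OF assms(1)]
  by (cases p) (auto simp: interpolant_def mem_rectangle_corners)

lemma interpolant_poly: "bidegree_poly_on 1 1 S (interpolant R g)"
proof -
  let ?a = "xmin R" and ?b = "xmax R" and ?c = "ymin R" and ?d = "ymax R"
  \<comment> \<open>the coefficients obtained by expanding the four products\<close>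
  define k where "k = 1 / ((?b - ?a) * (?d - ?c))"
  define C :: "nat \<Rightarrow> nat \<Rightarrow> real" where "C i j = k *
     (if i = 0 then
        if j = 0 then ?b * ?d * g (?a, ?c) - ?a * ?d * g (?b, ?c) - ?b * ?c * g (?a, ?d) + ?a * ?c * g (?b, ?d)
        else - ?b * g (?a, ?c) + ?a * g (?b, ?c) + ?b * g (?a, ?d) - ?a * g (?b, ?d)
      else
        if j = 0 then - ?d * g (?a, ?c) + ?d * g (?b, ?c) + ?c * g (?a, ?d) - ?c * g (?b, ?d)
        else g (?a, ?c) - g (?b, ?c) - g (?a, ?d) + g (?b, ?d))" for i j
  have "interpolant R g (x, y) = C 0 0 + C 0 1 * y + C 1 0 * x + C 1 1 * x * y" for x y
  proof -
    have "interpolant R g (x, y) = k *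
      ((?b - x) * (?d - y) * g (?a, ?c) + (x - ?a) * (?d - y) * g (?b, ?c) +
       (?b - x) * (y - ?c) * g (?a, ?d) + (x - ?a) * (y - ?c) * g (?b, ?d))"
      by (simp add: interpolant_def k_def)
    also have "\<dots> = C 0 0 + C 0 1 * y + C 1 0 * x + C 1 1 * x * y"
      unfolding C_def by (simp, algebra)
    finally show ?thesis .
  qed
  then show ?thesis
    unfolding bidegree_poly_on_def by (intro exI[of _ C]) (auto simp: algebra_simps)
qed

lemma bilinear_coefficients:
  assumes "bidegree_poly_on 1 1 S f"
  obtains c0 c1 c2 c3 where "\<And>p. p \<in> S \<Longrightarrow> f p = c0 + c1 * fst p + c2 * snd p + c3 * (fst p * snd p)"
proof -
  obtain c where c: "\<And>x y. (x, y) \<in> S \<Longrightarrow> f (x, y) = (\<Sum>i\<le>1. \<Sum>j\<le>1. c i j * x ^ i * y ^ j)"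
    using assms unfolding bidegree_poly_on_def by blast
  show ?thesis
    by (rule that[of "c 0 0" "c 1 0" "c 0 1" "c 1 1"])
      (use c[of "fst _" "snd _"] in \<open>auto simp: algebra_simps\<close>)
qed

lemma interpolant_bilinear:
  obtains c0 c1 c2 c3 where "\<And>p. interpolant R g p = c0 + c1 * fst p + c2 * snd p + c3 * (fst p * snd p)"
  using bilinear_coefficients[OF interpolant_poly[of UNIV R g]] by (metis UNIV_I)

lemma interpolant_reproduces:
  assumes R: "rectangle R" and f: "bidegree_poly_on 1 1 R f" and p: "p \<in> R"
  shows "f p = interpolant R f p"
proof -
  note ineq = rectangle_xmin_less[OF R] rectangle_ymin_less[OF R]
  obtain c0 c1 c2 c3 where c: "\<And>p. p \<in> R \<Longrightarrow> f p = c0 + c1 * fst p + c2 * snd p + c3 * (fst p * snd p)"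
    using bilinear_coefficients[OF f] by blast
  have corners: "(xmin R, ymin R) \<in> R" "(xmin R, ymax R) \<in> R" "(xmax R, ymin R) \<in> R" "(xmax R, ymax R) \<in> R"
    using ineq by (simp_all add: mem_rectangle[OF R])
  let ?k = "(xmax R - xmin R) * (ymax R - ymin R)"
  have "?k \<noteq> 0" using ineq by simp
  then show ?thesis
    unfolding interpolant_def c[OF p] c[OF corners(1)] c[OF corners(2)] c[OF corners(3)] c[OF corners(4)]
    by (subst nonzero_eq_divide_eq[OF \<open>?k \<noteq> 0\<close>], unfold fst_conv snd_conv) algebra
qed

lemma continuous_on_interpolant: "continuous_on S (interpolant R g)"
  unfolding interpolant_def divide_inverse by (intro continuous_intros)

lemma affine_eq_between:
  fixes a b x :: real
  assumes "k0 + k1 * a = l0 + l1 * a" "k0 + k1 * b = l0 + l1 * b" "a \<le> x" "x \<le> b"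
  shows "k0 + k1 * x = l0 + l1 * x"
proof (cases "a = b")
  case True
  then show ?thesis using assms by simp
next
  case False
  have "(k1 - l1) * (b - a) = 0" using assms by (simp add: algebra_simps)
  then have "k1 = l1" using False by simp
  then show ?thesis using assms by simp
qed

text \<open>
  Along a horizontal line an interpolant is affine, even beyond its rectangle.  Two of them with
  different rectangles are therefore compared at two points; this is what makes the pieces of a
  spline fit together along a common piece of side.
\<close>

lemma interpolants_eq_between_x:
  assumes "interpolant R f (a, y) = interpolant S g (a, y)"
    "interpolant R f (b, y) = interpolant S g (b, y)" "a \<le> x" "x \<le> b"
  shows "interpolant R f (x, y) = interpolant S g (x, y)"
proof -
  obtain c0 c1 c2 c3 where c: "\<And>p. interpolant R f p = c0 + c1 * fst p + c2 * snd p + c3 * (fst p * snd p)"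
    using interpolant_bilinear[of R f] by blast
  obtain d0 d1 d2 d3 where d: "\<And>p. interpolant S g p = d0 + d1 * fst p + d2 * snd p + d3 * (fst p * snd p)"
    using interpolant_bilinear[of S g] by blast
  have "(c0 + c2 * y) + (c1 + c3 * y) * x = (d0 + d2 * y) + (d1 + d3 * y) * x"
    by (rule affine_eq_between[of _ _ a _ _ b])
      (use assms in \<open>simp_all add: c d algebra_simps\<close>)
  then show ?thesis by (simp add: c d algebra_simps)
qed

lemma interpolants_eq_between_y:
  assumes "interpolant R f (x, a) = interpolant S g (x, a)"
    "interpolant R f (x, b) = interpolant S g (x, b)" "a \<le> y" "y \<le> b"
  shows "interpolant R f (x, y) = interpolant S g (x, y)"
proof -
  obtain c0 c1 c2 c3 where c: "\<And>p. interpolant R f p = c0 + c1 * fst p + c2 * snd p + c3 * (fst p * snd p)"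
    using interpolant_bilinear[of R f] by blast
  obtain d0 d1 d2 d3 where d: "\<And>p. interpolant S g p = d0 + d1 * fst p + d2 * snd p + d3 * (fst p * snd p)"
    using interpolant_bilinear[of S g] by blast
  have "(c0 + c1 * x) + (c2 + c3 * x) * y = (d0 + d1 * x) + (d2 + d3 * x) * y"
    by (rule affine_eq_between[of _ _ a _ _ b])
      (use assms in \<open>simp_all add: c d algebra_simps\<close>)
  then show ?thesis by (simp add: c d algebra_simps)
qed

text \<open>
  On a side of \<open>R\<close> the interpolant is a convex combination of the values at the two ends, with
  positive weights at an inner point.  A value \<open>M\<close> that bounds both ends can be reached there only
  if both ends have it.  Of the two ends the upper or right one has a larger coordinate sum than the
  point between them; this strict increase drives the maximum principle for the mesh.
\<close>

lemma maximum_propagates_from_hanging_vertex: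
  assumes R: "rectangle R" and v: "hangs v R" and le: "\<And>q. q \<in> rectangle_corners R \<Longrightarrow> g q \<le> M"
    and eq: "interpolant R g v = M"
  shows "\<exists>q \<in> rectangle_corners R. g q = M \<and> fst v + snd v < fst q + snd q"
proof -
  note ineq = rectangle_xmin_less[OF R] rectangle_ymin_less[OF R]
  have convex: "B = M" if "s < t" "t < u" "A \<le> M" "B \<le> M" 
      "((u - t) * A + (t - s) * B) / (u - s) = M" for s t u A B :: real
  proof -
    have "(u - t) * A + (t - s) * B = M * (u - s)" using that by (simp add: field_simps)
    moreover have "(u - t) * A \<le> (u - t) * M" using that by (intro mult_left_mono) auto
    ultimately have "(t - s) * M \<le> (t - s) * B" by (simp add: algebra_simps)
    with that show ?thesis by (simp add: mult_le_cancel_left)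
  qed
  have cancel: "(w * a * A + w * b * B) / (w * h) = (a * A + b * B) / h" "(a * w * A + b * w * B) / (h * w) = (a * A + b * B) / h"
    if "w \<noteq> 0" for w a b A B h :: real
    using that mult_divide_mult_cancel_left[of w "a * A + b * B" h] by (simp_all add: algebra_simps)
  consider "fst v = xmin R \<or> fst v = xmax R" "ymin R < snd v" "snd v < ymax R"
    | "snd v = ymin R \<or> snd v = ymax R" "xmin R < fst v" "fst v < xmax R"
    using v hangs_iff[OF R] by blast
  then show ?thesis
  proof cases
    case 1
    have "interpolant R g v = ((ymax R - snd v) * g (fst v, ymin R) + (snd v - ymin R) * g (fst v, ymax R)) / (ymax R - ymin R)"
      using 1(1) ineq cancel by (auto simp: interpolant_def)
    with eq have conv: "((ymax R - snd v) * g (fst v, ymin R) + (snd v - ymin R) * g (fst v, ymax R)) / (ymax R - ymin R) = M" by simp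
    have "g (fst v, ymax R) = M"
      by (rule convex[of "ymin R" "snd v" "ymax R" "g (fst v, ymin R)"]) (use 1 conv le in \<open>auto simp: mem_rectangle_corners[OF R]\<close>)
    then show ?thesis using 1
      by (intro bexI[of _ "(fst v, ymax R)"]) (auto simp: mem_rectangle_corners[OF R])
  next
    case 2
    have "interpolant R g v = ((xmax R - fst v) * g (xmin R, snd v) + (fst v - xmin R) * g (xmax R, snd v)) / (xmax R - xmin R)"
      using 2(1) ineq cancel by (auto simp: interpolant_def)
    with eq have conv: "((xmax R - fst v) * g (xmin R, snd v) + (fst v - xmin R) * g (xmax R, snd v)) / (xmax R - xmin R) = M" by simp
    have "g (xmax R, snd v) = M"
      by (rule convex[of "xmin R" "fst v" "xmax R" "g (xmin R, snd v)"]) (use 2 conv le in \<open>auto simp: mem_rectangle_corners[OF R]\<close>)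
    then show ?thesis using 2
      by (intro bexI[of _ "(xmax R, snd v)"]) (auto simp: mem_rectangle_corners[OF R])
  qed
qed

section \<open>Functions with finite support and linear maps\<close>

definition supported_on :: "'a set \<Rightarrow> ('a \<Rightarrow> real) set"
  where "supported_on A = {g. \<forall>v. v \<notin> A \<longrightarrow> g v = 0}"

lemma subspace_supported_on: "subspace (supported_on A)"
  by (rule subspaceI) (auto simp: supported_on_def scaleR_fun_def)

lemma sum_fun_apply: "(\<Sum>i\<in>I. f i) x = (\<Sum>i\<in>I. f i x)" for f :: "'i \<Rightarrow> 'a \<Rightarrow> real"
  by (induction I rule: infinite_finite_induct) auto

lemma supported_onD: "g \<in> supported_on A \<Longrightarrow> v \<notin> A \<Longrightarrow> g v = 0"
  by (simp add: supported_on_def)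

lemma scaleR_fun_apply: "(c *\<^sub>R f) x = c *\<^sub>R f x"
  by (simp add: scaleR_fun_def)

lemma supported_on_basis:
  assumes "finite A"
  obtains B where "finite B" "independent B" "span B = supported_on A" "card B = card A"
proof -
  define e :: "'a \<Rightarrow> 'a \<Rightarrow> real" where "e a v = (if v = a then 1 else 0)" for a v
  have inj: "inj e" by (rule injI) (metis e_def zero_neq_one)
  have "g \<in> span (e ` A)" if "g \<in> supported_on A" for g
  proof -
    have "g = (\<Sum>a\<in>A. g a *\<^sub>R e a)"
      using that assms by (auto simp: fun_eq_iff sum_fun_apply scaleR_fun_def e_def supported_on_def if_distrib[where f = "\<lambda>c. _ * c"] cong: if_cong)
    also have "\<dots> \<in> span (e ` A)"
      by (intro span_sum span_scale span_base) auto
    finally show ?thesis .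
  qed
  moreover have "e ` A \<subseteq> supported_on A" by (auto simp: supported_on_def e_def)
  then have "span (e ` A) \<subseteq> supported_on A"
    by (intro span_minimal subspace_supported_on)
  moreover have "independent (e ` A)"
  proof (rule independent_if_scalars_zero)
    show "finite (e ` A)" using assms by simp
    fix u f assume z: "(\<Sum>x\<in>e ` A. u x *\<^sub>R x) = 0" and "f \<in> e ` A"
    then obtain a where a: "a \<in> A" "f = e a" by blast
    have "0 = (\<Sum>x\<in>e ` A. u x *\<^sub>R x) a" using z by simp
    also have "\<dots> = (\<Sum>b\<in>A. u (e b) * e b a)"
      using inj by (subst sum.reindex) (auto simp: sum_fun_apply scaleR_fun_def intro: inj_on_subset)
    also have "\<dots> = u f" using a assms by (simp add: e_def if_distrib[where f = "\<lambda>c. _ * c"] cong: if_cong)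
    finally show "u f = 0" by simp
  qed
  ultimately show ?thesis
    using assms inj by (intro that[of "e ` A"]) (auto simp: card_image inj_on_subset)
qed

text \<open>
  The image of a basis is independent and has the same number of elements, so it cannot be
  enlarged to a bigger independent set within the span.  The ambient space may have infinite
  dimension, as the space of all functions on the plane has.
\<close>

lemma injective_endomorphism_surjective:
  fixes L :: "'a::real_vector \<Rightarrow> 'a"
  assumes L: "linear L" and B: "finite B" and into: "L ` span B \<subseteq> span B" and inj: "inj_on L (span B)"
  shows "L ` span B = span B"
proof -
  obtain C where C: "C \<subseteq> span B" "independent C" "span B \<subseteq> span C" "card C = dim (span B)"
    using basis_exists[of "span B"] by blast
  have spanC: "span C = span B"
    using C by (simp add: span_minimal subset_antisym)
  have finC: "finite C" 
    using independent_span_bound[OF B C(2) C(1)] by simp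
  have indep: "independent (L ` C)"
    using linear_independent_injective_image[OF L C(2)] inj spanC by simp
  have sub: "L ` C \<subseteq> span B" using C(1) into by blast
  have card: "card (L ` C) = card C"
    using inj C(1) by (intro card_image) (blast intro: inj_on_subset)
  obtain D where D: "L ` C \<subseteq> D" "D \<subseteq> span B" "independent D" "span B \<subseteq> span D"
    using maximal_independent_subset_extend[OF sub indep] by blast
  have "finite D \<and> card D \<le> card C"
    using independent_span_bound[OF finC D(3)] D(2) spanC by simp
  then have "L ` C = D" using D(1) card by (simp add: card_seteq)
  then show ?thesis using into D(4) spanC linear_span_image[OF L, of C] by auto
qed

text \<open>
  A basis of \<open>S\<close> is mapped to a basis of the span of \<open>B\<close>; this carries finite dimension from the
  image back to \<open>S\<close>.
\<close>

lemma linear_iso_pulls_back_basis: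
  fixes T :: "'a::real_vector \<Rightarrow> 'b::real_vector"
  assumes T: "linear T" and S: "subspace S" and inj: "inj_on T S"
    and B: "finite B" "independent B" and onto: "T ` S = span B"
  shows "(\<exists>C. finite C \<and> span C = S) \<and> dim S = card B"
proof -
  obtain D where D: "D \<subseteq> S" "independent D" "S \<subseteq> span D" "card D = dim S"
    using basis_exists by blast
  have spanD: "span D = S"
    using D S by (simp add: span_minimal subset_antisym)
  have indep: "independent (T ` D)"
    using linear_independent_injective_image[OF T D(2)] inj spanD by simp
  have span_image: "span (T ` D) = span B"
    using linear_span_image[OF T, of D] spanD onto by simp
  have "finite (T ` D)"
    using independent_span_bound[OF B(1) indep] span_image span_superset[of "T ` D"] by simp
  moreover have injD: "inj_on T D"
    using inj D(1) by (rule inj_on_subset)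
  ultimately have "finite D" by (simp add: finite_image_iff)
  moreover have "card (T ` D) = card B"
    using dim_eq_card[OF span_image indep] B(2) by (simp add: dim_eq_card_independent)
  ultimately show ?thesis
    using spanD D(4) card_image[OF injD] by auto
qed

section \<open>Axis directions and segments\<close>

definition axis_directions :: "(real \<times> real) set"
  where "axis_directions = {(1, 0), (-1, 0), (0, 1), (0, -1)}"

lemma card_axis_directions: "card axis_directions = 4"
  by (simp add: axis_directions_def)

lemma axis_direction_nonzero: "d \<in> axis_directions \<Longrightarrow> d \<noteq> 0"
  by (auto simp: axis_directions_def zero_prod_def)

lemma axis_direction_unique:
  assumes "d \<in> axis_directions" "d' \<in> axis_directions" "s *\<^sub>R d = s' *\<^sub>R d'" "0 < s" "0 < s'"
  shows "d = d'"
  using assms by (auto simp: axis_directions_def)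

lemma axis_parallel_iff:
  fixes v w :: "real \<times> real"
  assumes "v \<noteq> w"
  shows "fst v = fst w \<or> snd v = snd w \<longleftrightarrow> (\<exists>d\<in>axis_directions. \<exists>s>0. w = v + s *\<^sub>R d)"
proof
  assume par: "fst v = fst w \<or> snd v = snd w"
  let ?s = "\<bar>fst w - fst v\<bar> + \<bar>snd w - snd v\<bar>"
  have "?s > 0" using assms by (auto simp: prod_eq_iff)
  moreover have "w = v + ?s *\<^sub>R (1, 0) \<or> w = v + ?s *\<^sub>R (-1, 0) \<or> w = v + ?s *\<^sub>R (0, 1) \<or> w = v + ?s *\<^sub>R (0, -1)"
    using par by (auto simp: prod_eq_iff)
  ultimately show "\<exists>d\<in>axis_directions. \<exists>s>0. w = v + s *\<^sub>R d"
    unfolding axis_directions_def by blast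
qed (auto simp: axis_directions_def)

lemma mem_closed_segment_ray:
  fixes v d :: "'a::real_vector"
  assumes "0 < s"
  shows "p \<in> closed_segment v (v + s *\<^sub>R d) \<longleftrightarrow> (\<exists>t. 0 \<le> t \<and> t \<le> s \<and> p = v + t *\<^sub>R d)"
proof -
  have *: "(1 - u) *\<^sub>R v + u *\<^sub>R (v + s *\<^sub>R d) = v + (u * s) *\<^sub>R d" for u
    by (simp add: algebra_simps)
  show ?thesis
  proof
    assume "p \<in> closed_segment v (v + s *\<^sub>R d)"
    then obtain u where "0 \<le> u" "u \<le> 1" "p = v + (u * s) *\<^sub>R d" unfolding in_segment * by blast
    then show "\<exists>t. 0 \<le> t \<and> t \<le> s \<and> p = v + t *\<^sub>R d"
      using assms by (intro exI[of _ "u * s"]) (auto simp: mult_left_le_one_le)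
  next
    assume "\<exists>t. 0 \<le> t \<and> t \<le> s \<and> p = v + t *\<^sub>R d"
    then obtain t where "0 \<le> t" "t \<le> s" "p = v + t *\<^sub>R d" by blast
    then show "p \<in> closed_segment v (v + s *\<^sub>R d)"
      using assms unfolding in_segment * by (intro exI[of _ "t / s"]) auto
  qed
qed

lemma mem_open_segment_ray:
  fixes v d :: "'a::real_vector"
  assumes "0 < s" "d \<noteq> 0"
  shows "p \<in> open_segment v (v + s *\<^sub>R d) \<longleftrightarrow> (\<exists>t. 0 < t \<and> t < s \<and> p = v + t *\<^sub>R d)"
proof -
  have "v + t *\<^sub>R d \<noteq> v \<longleftrightarrow> t \<noteq> 0" "v + t *\<^sub>R d \<noteq> v + s *\<^sub>R d \<longleftrightarrow> t \<noteq> s" for t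
    using assms(2) by simp_all
  then show ?thesis
    unfolding open_segment_def using mem_closed_segment_ray[OF assms(1), of p v d]
    by (smt (verit) DiffD1 DiffD2 DiffI insertCI insertE empty_iff)
qed

section \<open>Cells and vertices of a regular mesh\<close>

locale regular_mesh =
  fixes F :: mesh
  assumes regular: "regular_T_mesh F"
begin

abbreviation "V \<equiv> mesh_vertices F"
abbreviation "\<Omega> \<equiv> mesh_region F"

lemma finite_cells: "finite F"
  and cell: "\<phi> \<in> F \<Longrightarrow> rectangle \<phi>"
  and disjoint: "\<phi> \<in> F \<Longrightarrow> \<psi> \<in> F \<Longrightarrow> \<phi> \<noteq> \<psi> \<Longrightarrow> interior \<phi> \<inter> interior \<psi> = {}"
  and region: "rectangle \<Omega>"
  using regular by (auto simp: regular_T_mesh_def T_mesh_def pairwise_def)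

lemma cells_apart:
  assumes "\<phi> \<in> F" "\<psi> \<in> F" "\<phi> \<noteq> \<psi>"
  shows "xmax \<phi> \<le> xmin \<psi> \<or> xmax \<psi> \<le> xmin \<phi> \<or> ymax \<phi> \<le> ymin \<psi> \<or> ymax \<psi> \<le> ymin \<phi>"
proof (rule ccontr)
  assume "\<not> ?thesis"
  note ineqs = this rectangle_xmin_less[OF cell[OF assms(1)]] rectangle_ymin_less[OF cell[OF assms(1)]]
    rectangle_xmin_less[OF cell[OF assms(2)]] rectangle_ymin_less[OF cell[OF assms(2)]]
  have "max (xmin \<phi>) (xmin \<psi>) < min (xmax \<phi>) (xmax \<psi>)" using ineqs by auto
  then obtain x where "max (xmin \<phi>) (xmin \<psi>) < x" "x < min (xmax \<phi>) (xmax \<psi>)"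
    using dense by blast
  moreover have "max (ymin \<phi>) (ymin \<psi>) < min (ymax \<phi>) (ymax \<psi>)" using ineqs by auto
  then obtain y where "max (ymin \<phi>) (ymin \<psi>) < y" "y < min (ymax \<phi>) (ymax \<psi>)"
    using dense by blast
  ultimately have "(x, y) \<in> interior \<phi> \<inter> interior \<psi>"
    by (simp add: mem_interior_rectangle cell assms)
  then show False using disjoint[OF assms] by simp
qed

lemma vertex_iff: "v \<in> V \<longleftrightarrow> (\<exists>\<phi>\<in>F. v \<in> rectangle_corners \<phi>)"
  by (simp add: mesh_vertices_def)

lemma finite_vertices: "finite V"
  unfolding mesh_vertices_def using finite_cells by (auto simp: rectangle_corners_eq cell)

lemma interior_misses_other_cells:
  assumes "\<phi> \<in> F" "\<psi> \<in> F" "p \<in> interior \<phi>" "p \<in> \<psi>"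
  shows "\<psi> = \<phi>"
  using cells_apart[OF assms(1,2)] assms
  by (auto simp: mem_interior_rectangle mem_rectangle cell)

lemma vertex_not_interior:
  assumes "\<phi> \<in> F" "v \<in> V"
  shows "v \<notin> interior \<phi>"
proof
  assume v: "v \<in> interior \<phi>"
  obtain \<psi> where "\<psi> \<in> F" "v \<in> rectangle_corners \<psi>" using assms(2) vertex_iff by blast
  moreover from this have "v \<in> \<psi>" "v \<notin> interior \<psi>"
    using rectangle_xmin_less[OF cell] rectangle_ymin_less[OF cell]
    by (auto simp: mem_rectangle mem_interior_rectangle mem_rectangle_corners cell less_imp_le)
  ultimately show False using interior_misses_other_cells[OF assms(1) _ v] v by blast
qed

lemma vertex_in_cell:
  assumes "\<phi> \<in> F" "v \<in> V" "v \<in> \<phi>"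
  shows "v \<in> rectangle_corners \<phi> \<or> hangs v \<phi>"
  using vertex_not_interior[OF assms(1,2)] assms
  by (auto simp: hangs_def mem_frontier_rectangle cell)

text \<open>
  Near \<open>v\<close> the cell \<open>\<phi>\<close> fills a half-disc, so every other cell at \<open>v\<close> lies on the opposite side of
  the line that carries the side of \<open>\<phi>\<close>.
\<close>

lemma hanging_separates:
  assumes \<phi>: "\<phi> \<in> F" "hangs v \<phi>" and \<psi>: "\<psi> \<in> F" "v \<in> \<psi>" "\<psi> \<noteq> \<phi>"
  shows "fst v = xmin \<phi> \<and> fst v = xmax \<psi> \<and> ymin \<phi> < snd v \<and> snd v < ymax \<phi> \<or>
    fst v = xmax \<phi> \<and> fst v = xmin \<psi> \<and> ymin \<phi> < snd v \<and> snd v < ymax \<phi> \<or>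
    snd v = ymin \<phi> \<and> snd v = ymax \<psi> \<and> xmin \<phi> < fst v \<and> fst v < xmax \<phi> \<or>
    snd v = ymax \<phi> \<and> snd v = ymin \<psi> \<and> xmin \<phi> < fst v \<and> fst v < xmax \<phi>"
  using cells_apart[OF \<psi>(1) \<phi>(1) \<psi>(3)] \<phi>(2) \<psi>(2)
    rectangle_xmin_less[OF cell[OF \<phi>(1)]] rectangle_ymin_less[OF cell[OF \<phi>(1)]]
  unfolding hangs_iff[OF cell[OF \<phi>(1)]] mem_rectangle[OF cell[OF \<psi>(1)]]
  by argo

text \<open>
  If \<open>v\<close> hung on two cells, these would fill two complementary half-discs around \<open>v\<close> and leave no
  room for the cell that has \<open>v\<close> as a corner.  Hence each hanging vertex gives exactly one
  interpolation condition.
\<close>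

lemma hangs_on_unique_cell:
  assumes "v \<in> V" "\<phi> \<in> F" "\<psi> \<in> F" "hangs v \<phi>" "hangs v \<psi>"
  shows "\<phi> = \<psi>"
proof (rule ccontr)
  assume "\<phi> \<noteq> \<psi>"
  obtain \<rho> where \<rho>: "\<rho> \<in> F" "v \<in> rectangle_corners \<rho>" using assms(1) vertex_iff by blast
  then have ne: "\<rho> \<noteq> \<phi>" "\<rho> \<noteq> \<psi>" using assms(4,5) by (auto simp: hangs_def)
  have "v \<in> \<psi>" using assms(3,5) by (simp add: hangs_def mem_frontier_rectangle cell)
  have "v \<in> \<rho>" using \<rho> rectangle_corners_subset[OF cell] by blast
  show False
    using hanging_separates[OF assms(2,4,3) \<open>v \<in> \<psi>\<close> \<open>\<phi> \<noteq> \<psi>\<close>[symmetric]]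
      hanging_separates[OF assms(2,4) \<rho>(1) \<open>v \<in> \<rho>\<close> ne(1)]
      hanging_separates[OF assms(3,5) \<rho>(1) \<open>v \<in> \<rho>\<close> ne(2)]
      rectangle_xmin_less[OF cell[OF \<rho>(1)]] rectangle_ymin_less[OF cell[OF \<rho>(1)]]
      rectangle_xmin_less[OF cell[OF assms(3)]] rectangle_ymin_less[OF cell[OF assms(3)]]
      rectangle_xmin_less[OF cell[OF assms(2)]] rectangle_ymin_less[OF cell[OF assms(2)]]
    by argo
qed

section \<open>Crossing vertices are the interior vertices that hang on no cell\<close>

text \<open>
  The edges at a vertex are counted by their directions.  The vertex reached need not be the next
  one; \<open>edge_to_next_vertex\<close> shortens the segment to an edge.
\<close>

definition edge_leaves :: "real \<times> real \<Rightarrow> real \<times> real \<Rightarrow> bool"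
  where "edge_leaves v d \<longleftrightarrow>
    (\<exists>s>0. v + s *\<^sub>R d \<in> V \<and> (\<forall>t. 0 \<le> t \<and> t \<le> s \<longrightarrow> v + t *\<^sub>R d \<in> (\<Union>\<phi>\<in>F. frontier \<phi>)))"

definition next_vertex_distance :: "real \<times> real \<Rightarrow> real \<times> real \<Rightarrow> real"
  where "next_vertex_distance v d = Min {s. 0 < s \<and> v + s *\<^sub>R d \<in> V}"

lemma finite_vertex_distances:
  assumes "d \<noteq> 0"
  shows "finite {s. 0 < s \<and> v + s *\<^sub>R d \<in> V}"
proof (rule finite_subset)
  show "{s. 0 < s \<and> v + s *\<^sub>R d \<in> V} \<subseteq> (\<lambda>s. v + s *\<^sub>R d) -` V" by auto
  show "finite ((\<lambda>s. v + s *\<^sub>R d) -` V)"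
    using assms by (intro finite_vimageI finite_vertices) (auto simp: inj_on_def)
qed

lemma edge_to_next_vertex:
  assumes v: "v \<in> V" and d: "d \<in> axis_directions" and leaves: "edge_leaves v d"
  shows "0 < next_vertex_distance v d" "closed_segment v (v + next_vertex_distance v d *\<^sub>R d) \<in> mesh_edges F"
proof -
  let ?S = "{s. 0 < s \<and> v + s *\<^sub>R d \<in> V}"
  have d0: "d \<noteq> 0" using axis_direction_nonzero[OF d] .
  obtain s where s: "0 < s" "v + s *\<^sub>R d \<in> V"
      "\<And>t. 0 \<le> t \<Longrightarrow> t \<le> s \<Longrightarrow> v + t *\<^sub>R d \<in> (\<Union>\<phi>\<in>F. frontier \<phi>)"
    using leaves unfolding edge_leaves_def by blast
  have "next_vertex_distance v d \<in> ?S"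
    unfolding next_vertex_distance_def using s finite_vertex_distances[OF d0] by (intro Min_in) auto
  then show pos: "0 < next_vertex_distance v d" by simp
  have le: "next_vertex_distance v d \<le> r" if "0 < r" "v + r *\<^sub>R d \<in> V" for r
    unfolding next_vertex_distance_def using that finite_vertex_distances[OF d0] by (intro Min_le) auto
  have "closed_segment v (v + next_vertex_distance v d *\<^sub>R d) \<subseteq> (\<Union>\<phi>\<in>F. frontier \<phi>)"
    using s(3) le[OF s(1,2)] by (auto simp: mem_closed_segment_ray[OF pos])
  moreover have "open_segment v (v + next_vertex_distance v d *\<^sub>R d) \<inter> V = {}"
  proof (intro equals0I)
    fix p assume p: "p \<in> open_segment v (v + next_vertex_distance v d *\<^sub>R d) \<inter> V"
    then obtain t where "0 < t" "t < next_vertex_distance v d" "p = v + t *\<^sub>R d"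
      unfolding Int_iff mem_open_segment_ray[OF pos d0] by blast
    then show False using le[of t] p by simp
  qed
  moreover have "v \<noteq> v + next_vertex_distance v d *\<^sub>R d" using pos d0 by simp
  moreover have "fst v = fst (v + next_vertex_distance v d *\<^sub>R d) \<or> snd v = snd (v + next_vertex_distance v d *\<^sub>R d)"
    using d by (auto simp: axis_directions_def)
  moreover have "v + next_vertex_distance v d *\<^sub>R d \<in> V" using \<open>next_vertex_distance v d \<in> ?S\<close> by simp
  ultimately show "closed_segment v (v + next_vertex_distance v d *\<^sub>R d) \<in> mesh_edges F"
    unfolding mesh_edges_def using v by blast
qed

lemma edge_at_vertexE:
  assumes v: "v \<in> V" and e: "e \<in> mesh_edges F" "v \<in> e"
  obtains d where "d \<in> axis_directions" "edge_leaves v d" "e = closed_segment v (v + next_vertex_distance v d *\<^sub>R d)"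
proof -
  obtain a b where ab: "e = closed_segment a b" "a \<in> V" "b \<in> V" "a \<noteq> b" "fst a = fst b \<or> snd a = snd b"
      "closed_segment a b \<subseteq> (\<Union>\<phi>\<in>F. frontier \<phi>)" "open_segment a b \<inter> V = {}"
    using e(1) unfolding mesh_edges_def by blast
  have "v = a \<or> v = b" using v e(2) ab by (auto simp: open_segment_def)
  then obtain w where w: "e = closed_segment v w" "w \<in> V" "v \<noteq> w" "fst v = fst w \<or> snd v = snd w"
      "closed_segment v w \<subseteq> (\<Union>\<phi>\<in>F. frontier \<phi>)" "open_segment v w \<inter> V = {}"
  proof
    assume "v = a"
    then show ?thesis using ab by (intro that[of b]) simp_all
  next
    assume "v = b"
    then show ?thesis using ab
      by (intro that[of a]) (auto simp: closed_segment_commute[of b a] open_segment_commute[of b a])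
  qed
  obtain d s where d: "d \<in> axis_directions" "0 < s" "w = v + s *\<^sub>R d"
    using axis_parallel_iff[OF w(3)] w(4) by blast
  note d0 = axis_direction_nonzero[OF d(1)]
  have "next_vertex_distance v d = s" unfolding next_vertex_distance_def
  proof (rule Min_eqI[OF finite_vertex_distances[OF d0]])
    show "s \<le> r" if "r \<in> {s. 0 < s \<and> v + s *\<^sub>R d \<in> V}" for r
    proof (rule ccontr)
      assume "\<not> s \<le> r"
      then have "v + r *\<^sub>R d \<in> open_segment v w"
        unfolding d(3) mem_open_segment_ray[OF d(2) d0] using that by auto
      then show False using that w(6) by blast
    qed
  qed (use d w in auto)
  moreover have "edge_leaves v d"
    unfolding edge_leaves_def
  proof (intro exI[of _ s] conjI allI impI)
    fix t assume "0 \<le> t \<and> t \<le> s"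
    then have "v + t *\<^sub>R d \<in> closed_segment v w"
      unfolding d(3) mem_closed_segment_ray[OF d(2)] by blast
    then show "v + t *\<^sub>R d \<in> (\<Union>\<phi>\<in>F. frontier \<phi>)" using w(5) by blast
  qed (use d w(2) in auto)
  ultimately show ?thesis using that d w(1) by blast
qed

text \<open>
  An edge contains no vertex besides its ends, so two edges leaving \<open>v\<close> in the same direction end at
  the same next vertex: edges at \<open>v\<close> correspond to the directions they take.
\<close>

lemma card_edges_at_vertex:
  assumes v: "v \<in> V"
  shows "card {e \<in> mesh_edges F. v \<in> e} = card {d \<in> axis_directions. edge_leaves v d}"
proof -
  let ?e = "\<lambda>d. closed_segment v (v + next_vertex_distance v d *\<^sub>R d)" and ?D = "{d \<in> axis_directions. edge_leaves v d}"
  have "{e \<in> mesh_edges F. v \<in> e} = ?e ` ?D"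
  proof (intro set_eqI iffI)
    fix e assume "e \<in> {e \<in> mesh_edges F. v \<in> e}"
    then show "e \<in> ?e ` ?D" using edge_at_vertexE[OF v, of e] by blast
  next
    fix e assume "e \<in> ?e ` ?D"
    then show "e \<in> {e \<in> mesh_edges F. v \<in> e}" using edge_to_next_vertex(2)[OF v] by auto
  qed
  moreover have "inj_on ?e ?D"
  proof (rule inj_onI)
    fix d d' assume d: "d \<in> ?D" and d': "d' \<in> ?D" and eq: "?e d = ?e d'"
    have pos: "0 < next_vertex_distance v d" "0 < next_vertex_distance v d'" using d d' edge_to_next_vertex(1)[OF v] by auto
    have "v + next_vertex_distance v d *\<^sub>R d \<in> ?e d'" unfolding eq[symmetric] by simp
    then obtain t where t: "0 \<le> t" "next_vertex_distance v d *\<^sub>R d = t *\<^sub>R d'"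
      using mem_closed_segment_ray[OF pos(2), of "v + next_vertex_distance v d *\<^sub>R d" v d'] by auto
    then have "t \<noteq> 0" using pos(1) axis_direction_nonzero[of d] d by auto
    then show "d = d'" using axis_direction_unique[OF _ _ t(2)] t(1) pos(1) d d' by simp
  qed
  ultimately show ?thesis by (simp add: card_image)
qed

lemma crossing_iff_edges_all_around:
  "v \<in> crossing_vertices F \<longleftrightarrow> v \<in> V \<and> v \<notin> frontier \<Omega> \<and> (\<forall>d\<in>axis_directions. edge_leaves v d)"
proof -
  have fin: "finite axis_directions" by (simp add: axis_directions_def)
  have "card {d \<in> axis_directions. edge_leaves v d} = 4 \<longleftrightarrow> (\<forall>d\<in>axis_directions. edge_leaves v d)"
  proof
    assume "card {d \<in> axis_directions. edge_leaves v d} = 4"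
    then have "{d \<in> axis_directions. edge_leaves v d} = axis_directions"
      using fin by (intro card_subset_eq) (auto simp: card_axis_directions)
    then show "\<forall>d\<in>axis_directions. edge_leaves v d" by blast
  next
    assume "\<forall>d\<in>axis_directions. edge_leaves v d"
    then have "{d \<in> axis_directions. edge_leaves v d} = axis_directions" by blast
    then show "card {d \<in> axis_directions. edge_leaves v d} = 4" by (simp add: card_axis_directions)
  qed
  then show ?thesis
    unfolding crossing_vertices_def interior_vertices_def by (auto simp: card_edges_at_vertex)
qed

text \<open>
  The direction from \<open>v\<close> into the interior of the cell on which it hangs carries no edge, because
  the interior of a cell meets no cell boundary.
\<close>

lemma hanging_blocks_direction:
  assumes \<phi>: "\<phi> \<in> F" and h: "hangs v \<phi>"
  shows "\<exists>d\<in>axis_directions. \<not> edge_leaves v d"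
proof -
  note ineq = rectangle_xmin_less[OF cell[OF \<phi>]] rectangle_ymin_less[OF cell[OF \<phi>]]
  define w where "w = min (xmax \<phi> - xmin \<phi>) (ymax \<phi> - ymin \<phi>)"
  have w: "0 < w" using ineq by (simp add: w_def)
  consider (left) "fst v = xmin \<phi>" "ymin \<phi> < snd v" "snd v < ymax \<phi>"
    | (right) "fst v = xmax \<phi>" "ymin \<phi> < snd v" "snd v < ymax \<phi>"
    | (bottom) "snd v = ymin \<phi>" "xmin \<phi> < fst v" "fst v < xmax \<phi>"
    | (top) "snd v = ymax \<phi>" "xmin \<phi> < fst v" "fst v < xmax \<phi>"
    using h hangs_iff[OF cell[OF \<phi>]] by blast
  then have "\<exists>d\<in>axis_directions. \<forall>t. 0 < t \<and> t < w \<longrightarrow> v + t *\<^sub>R d \<in> interior \<phi>"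
  proof cases
    case left then show ?thesis
      by (intro bexI[of _ "(1, 0)"]) (auto simp: mem_interior_rectangle[OF cell[OF \<phi>]] axis_directions_def w_def)
  next
    case right then show ?thesis
      by (intro bexI[of _ "(-1, 0)"]) (auto simp: mem_interior_rectangle[OF cell[OF \<phi>]] axis_directions_def w_def)
  next
    case bottom then show ?thesis
      by (intro bexI[of _ "(0, 1)"]) (auto simp: mem_interior_rectangle[OF cell[OF \<phi>]] axis_directions_def w_def)
  next
    case top then show ?thesis
      by (intro bexI[of _ "(0, -1)"]) (auto simp: mem_interior_rectangle[OF cell[OF \<phi>]] axis_directions_def w_def)
  qed
  then obtain d where d: "d \<in> axis_directions" "\<And>t. 0 < t \<Longrightarrow> t < w \<Longrightarrow> v + t *\<^sub>R d \<in> interior \<phi>" by blast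
  have "\<not> edge_leaves v d"
  proof
    assume "edge_leaves v d"
    then obtain s where s: "0 < s" "\<And>t. 0 \<le> t \<Longrightarrow> t \<le> s \<Longrightarrow> v + t *\<^sub>R d \<in> (\<Union>\<phi>\<in>F. frontier \<phi>)"
      unfolding edge_leaves_def by blast
    let ?p = "v + min s (w / 2) *\<^sub>R d"
    obtain \<psi> where "\<psi> \<in> F" "?p \<in> frontier \<psi>" using s(1) s(2)[of "min s (w / 2)"] w by auto
    moreover have "?p \<in> interior \<phi>" using s(1) w by (intro d(2)) auto
    ultimately show False
      using interior_misses_other_cells[OF \<phi>, of \<psi> ?p] mem_frontier_rectangle[OF cell, of \<psi> ?p] by blast
  qed
  with d(1) show ?thesis by blast
qed

text \<open>
  The cells that avoid \<open>v\<close> form a closed set, so a small enough step from \<open>v\<close> ends in a cell that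
  contains \<open>v\<close>.
\<close>

lemma cell_in_direction:
  assumes "v \<in> interior \<Omega>"
  obtains \<phi> \<epsilon> where "\<phi> \<in> F" "v \<in> \<phi>" "0 < \<epsilon>" "v + \<epsilon> *\<^sub>R q \<in> \<phi>"
proof -
  let ?U = "interior \<Omega> - \<Union>{\<phi> \<in> F. v \<notin> \<phi>}"
  have "open ?U"
    using finite_cells by (intro open_Diff open_interior closed_Union) (auto intro: closed_rectangle cell)
  moreover have "v \<in> ?U" using assms by blast
  ultimately obtain r where r: "0 < r" "ball v r \<subseteq> ?U" by (meson openE)
  \<comment> \<open>short enough for every length of \<open>q\<close>, zero included\<close>
  define \<epsilon> where "\<epsilon> = r / (2 * (norm q + 1))"
  have pos: "0 < norm q + 1" by (smt (verit) norm_ge_zero)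
  have eps: "0 < \<epsilon>" using r(1) pos by (simp add: \<epsilon>_def)
  have "norm (\<epsilon> *\<^sub>R q) = \<epsilon> * norm q" using eps by simp
  also have "\<dots> \<le> \<epsilon> * (norm q + 1)" using eps by simp
  also have "\<dots> < 2 * \<epsilon> * (norm q + 1)" using eps pos by simp
  also have "\<dots> = r" using pos by (simp add: \<epsilon>_def field_simps)
  finally have "v + \<epsilon> *\<^sub>R q \<in> ball v r" by (simp add: dist_norm)
  then have "v + \<epsilon> *\<^sub>R q \<in> ?U" using r(2) by blast
  then obtain \<phi> where "\<phi> \<in> F" "v + \<epsilon> *\<^sub>R q \<in> \<phi>" "v \<in> \<phi>"
    using interior_subset[of \<Omega>] unfolding mesh_region_def by blast
  then show ?thesis using that eps by blast
qed

text \<open>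
  A cell occupying a quadrant at \<open>v\<close> next to the direction \<open>d\<close> has \<open>v\<close> as a corner, and its side
  from \<open>v\<close> in direction \<open>d\<close> ends at a vertex.
\<close>

lemma edge_leaves_if_not_hanging:
  assumes v: "v \<in> V" "v \<in> interior \<Omega>" and free: "\<And>\<phi>. \<phi> \<in> F \<Longrightarrow> \<not> hangs v \<phi>" and d: "d \<in> axis_directions"
  shows "edge_leaves v d"
proof -
  \<comment> \<open>the diagonal of a quadrant adjacent to \<open>d\<close>\<close>
  obtain \<phi> \<epsilon> where \<phi>: "\<phi> \<in> F" "v \<in> \<phi>" "0 < \<epsilon>" "v + \<epsilon> *\<^sub>R (d + (snd d, fst d)) \<in> \<phi>"
    using cell_in_direction[OF v(2)] by blast
  note R = cell[OF \<phi>(1)]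
  note ineq = rectangle_xmin_less[OF R] rectangle_ymin_less[OF R]
  have corner: "v \<in> rectangle_corners \<phi>" using vertex_in_cell[OF \<phi>(1) v(1) \<phi>(2)] free \<phi>(1) by blast
  note facts = corner[unfolded mem_rectangle_corners[OF R]] \<phi>(4)[unfolded mem_rectangle[OF R]]
  consider "d = (1, 0)" | "d = (-1, 0)" | "d = (0, 1)" | "d = (0, -1)"
    using d unfolding axis_directions_def by blast
  then have "\<exists>s>0. v + s *\<^sub>R d \<in> rectangle_corners \<phi> \<and> (\<forall>t. 0 \<le> t \<and> t \<le> s \<longrightarrow> v + t *\<^sub>R d \<in> frontier \<phi>)"
  proof cases
    case 1
    then have "v = (xmin \<phi>, ymin \<phi>)" using facts \<phi>(3) by (intro prod_eqI) auto
    then show ?thesis using 1 ineq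
      by (intro exI[of _ "xmax \<phi> - xmin \<phi>"])
        (simp add: mem_rectangle_corners[OF R] mem_frontier_rectangle[OF R] mem_rectangle[OF R] mem_interior_rectangle[OF R])
  next
    case 2
    then have "v = (xmax \<phi>, ymax \<phi>)" using facts \<phi>(3) by (intro prod_eqI) auto
    then show ?thesis using 2 ineq
      by (intro exI[of _ "xmax \<phi> - xmin \<phi>"])
        (simp add: mem_rectangle_corners[OF R] mem_frontier_rectangle[OF R] mem_rectangle[OF R] mem_interior_rectangle[OF R])
  next
    case 3
    then have "v = (xmin \<phi>, ymin \<phi>)" using facts \<phi>(3) by (intro prod_eqI) auto
    then show ?thesis using 3 ineq
      by (intro exI[of _ "ymax \<phi> - ymin \<phi>"])
        (simp add: mem_rectangle_corners[OF R] mem_frontier_rectangle[OF R] mem_rectangle[OF R] mem_interior_rectangle[OF R])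
  next
    case 4
    then have "v = (xmax \<phi>, ymax \<phi>)" using facts \<phi>(3) by (intro prod_eqI) auto
    then show ?thesis using 4 ineq
      by (intro exI[of _ "ymax \<phi> - ymin \<phi>"])
        (simp add: mem_rectangle_corners[OF R] mem_frontier_rectangle[OF R] mem_rectangle[OF R] mem_interior_rectangle[OF R])
  qed
  then show ?thesis
    unfolding edge_leaves_def using \<phi>(1) vertex_iff by blast
qed

lemma crossing_iff:
  "v \<in> crossing_vertices F \<longleftrightarrow> v \<in> V \<and> v \<notin> frontier \<Omega> \<and> (\<forall>\<phi>\<in>F. \<not> hangs v \<phi>)"
proof (cases "v \<in> V \<and> v \<notin> frontier \<Omega>")
  case True
  then obtain \<phi> where "\<phi> \<in> F" "v \<in> rectangle_corners \<phi>" using vertex_iff by blast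
  then have "v \<in> \<Omega>" using rectangle_corners_subset[OF cell] unfolding mesh_region_def by blast
  then have "v \<in> interior \<Omega>" using True by (simp add: mem_frontier_rectangle region)
  then have "(\<forall>d\<in>axis_directions. edge_leaves v d) \<longleftrightarrow> (\<forall>\<phi>\<in>F. \<not> hangs v \<phi>)"
    using hanging_blocks_direction[of _ v] edge_leaves_if_not_hanging[of v] True by auto
  then show ?thesis using True unfolding crossing_iff_edges_all_around by simp
qed (auto simp: crossing_iff_edges_all_around)

section \<open>The maximum principle\<close>

text \<open>
  A boundary point of the region in a cell lies on a side of the cell that is contained in the
  boundary, and both ends of that side are boundary vertices.
\<close>

lemma interpolant_zero_on_boundary:
  assumes \<phi>: "\<phi> \<in> F" and p: "p \<in> \<phi>" "p \<in> frontier \<Omega>"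
    and zero: "\<And>v. v \<in> V \<Longrightarrow> v \<in> frontier \<Omega> \<Longrightarrow> g v = 0"
  shows "interpolant \<phi> g p = 0"
proof -
  note R = cell[OF \<phi>]
  note ineq = rectangle_xmin_less[OF R] rectangle_ymin_less[OF R]
  have sub: "\<phi> \<subseteq> \<Omega>" using \<phi> unfolding mesh_region_def by blast
  have "(xmin \<phi>, ymin \<phi>) \<in> \<phi>" "(xmax \<phi>, ymax \<phi>) \<in> \<phi>"
    using ineq by (simp_all add: mem_rectangle[OF R])
  then have "(xmin \<phi>, ymin \<phi>) \<in> \<Omega>" "(xmax \<phi>, ymax \<phi>) \<in> \<Omega>" using sub by blast+
  then have bounds: "xmin \<Omega> \<le> xmin \<phi>" "xmax \<phi> \<le> xmax \<Omega>" "ymin \<Omega> \<le> ymin \<phi>" "ymax \<phi> \<le> ymax \<Omega>"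
    unfolding mem_rectangle[OF region] by simp_all
  have zero_corner: "g q = 0"
    if "q \<in> rectangle_corners \<phi>" "fst q = xmin \<Omega> \<or> fst q = xmax \<Omega> \<or> snd q = ymin \<Omega> \<or> snd q = ymax \<Omega>" for q
  proof (rule zero)
    show "q \<in> V" using that(1) \<phi> vertex_iff by blast
    have "q \<in> \<Omega>" using that(1) sub rectangle_corners_subset[OF R] by blast
    then show "q \<in> frontier \<Omega>"
      using that(2) unfolding mem_frontier_rectangle[OF region] mem_interior_rectangle[OF region] by auto
  qed
  have "fst p = xmin \<Omega> \<or> fst p = xmax \<Omega> \<or> snd p = ymin \<Omega> \<or> snd p = ymax \<Omega>"
    using p(2) unfolding mem_frontier_rectangle[OF region] mem_interior_rectangle[OF region] mem_rectangle[OF region]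
    by linarith
  then consider "fst p = xmin \<phi>" "xmin \<phi> = xmin \<Omega>" | "fst p = xmax \<phi>" "xmax \<phi> = xmax \<Omega>"
    | "snd p = ymin \<phi>" "ymin \<phi> = ymin \<Omega>" | "snd p = ymax \<phi>" "ymax \<phi> = ymax \<Omega>"
    using p(1) bounds unfolding mem_rectangle[OF R] by linarith
  then show ?thesis
    by cases (simp_all add: interpolant_def zero_corner mem_rectangle_corners[OF R])
qed

text \<open>
  Among the vertices where \<open>g\<close> attains a positive maximum, take one with the largest coordinate sum.
  It hangs on a cell, and one end of the side through it has the same value and a larger coordinate
  sum.
\<close>

lemma maximum_principle:
  assumes "\<And>v. v \<in> V \<Longrightarrow> g v \<le> 0 \<or> (\<exists>\<phi>\<in>F. hangs v \<phi> \<and> g v = interpolant \<phi> g v)"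
    and "v \<in> V"
  shows "g v \<le> 0"
proof (rule ccontr)
  assume "\<not> g v \<le> 0"
  define M where "M = Max (g ` V)"
  have le: "g q \<le> M" if "q \<in> V" for q
    using that finite_vertices by (simp add: M_def)
  have "0 < M" using \<open>\<not> g v \<le> 0\<close> le[OF assms(2)] by linarith
  let ?T = "{q \<in> V. g q = M}"
  have "M \<in> g ` V" unfolding M_def using assms(2) finite_vertices by (intro Max_in) auto
  then have T: "?T \<noteq> {}" "finite ?T" using finite_vertices by auto
  let ?w = "\<lambda>q. fst q + snd q"
  have "Max (?w ` ?T) \<in> ?w ` ?T" using T by (intro Max_in) auto
  then obtain u where u: "?w u = Max (?w ` ?T)" "u \<in> ?T" by (elim imageE) simp
  have u_max: "?w q \<le> ?w u" if "q \<in> ?T" for q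
    unfolding u(1) using that T(2) by (intro Max_ge) auto
  have "u \<in> V" "g u = M" using u(2) by simp_all
  then obtain \<phi> where \<phi>: "\<phi> \<in> F" "hangs u \<phi>" "interpolant \<phi> g u = M"
    using assms(1)[OF \<open>u \<in> V\<close>] \<open>0 < M\<close> by auto
  have "g q \<le> M" if "q \<in> rectangle_corners \<phi>" for q
    using le that \<phi>(1) vertex_iff by blast
  then obtain q where q: "q \<in> rectangle_corners \<phi>" "g q = M" "?w u < ?w q"
    using maximum_propagates_from_hanging_vertex[OF cell[OF \<phi>(1)] \<phi>(2) _ \<phi>(3)] by blast
  have "q \<in> ?T" using q(1,2) \<phi>(1) vertex_iff by blast
  then show False using u_max[of q] q(3) by simp
qed

lemma zero_if_interpolated_where_nonzero:
  assumes "\<And>v. v \<in> V \<Longrightarrow> g v = 0 \<or> (\<exists>\<phi>\<in>F. hangs v \<phi> \<and> g v = interpolant \<phi> g v)"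
    and "v \<in> V"
  shows "g v = 0"
proof -
  have "g v \<le> 0"
  proof (rule maximum_principle[OF _ assms(2)])
    show "g u \<le> 0 \<or> (\<exists>\<phi>\<in>F. hangs u \<phi> \<and> g u = interpolant \<phi> g u)" if "u \<in> V" for u
      using assms(1)[OF that] by auto
  qed
  moreover have "((-1) *\<^sub>R g) v \<le> 0"
  proof (rule maximum_principle[OF _ assms(2)])
    fix u assume "u \<in> V"
    from assms(1)[OF this]
    show "((-1) *\<^sub>R g) u \<le> 0 \<or> (\<exists>\<phi>\<in>F. hangs u \<phi> \<and> ((-1) *\<^sub>R g) u = interpolant \<phi> ((-1) *\<^sub>R g) u)"
      unfolding interpolant_scaleR scaleR_fun_apply by auto
  qed
  ultimately show ?thesis by (simp add: scaleR_fun_apply)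
qed

section \<open>Solving for the values at hanging vertices\<close>

definition through_cell :: "real \<times> real \<Rightarrow> (real \<times> real) set"
  where "through_cell v = (SOME \<phi>. \<phi> \<in> F \<and> hangs v \<phi>)"

lemma through_cell_eq: "v \<in> V \<Longrightarrow> \<phi> \<in> F \<Longrightarrow> hangs v \<phi> \<Longrightarrow> through_cell v = \<phi>"
  unfolding through_cell_def by (rule some_equality) (simp, metis hangs_on_unique_cell)

text \<open>
  The defect of the interpolation conditions at interior hanging vertices, and the value itself at
  all other vertices.  There are as many components as vertices, which makes the system square.
\<close>

definition residual :: "(real \<times> real \<Rightarrow> real) \<Rightarrow> real \<times> real \<Rightarrow> real"
  where "residual g v =
    (if v \<notin> V then 0
     else if v \<notin> frontier \<Omega> \<and> (\<exists>\<phi>\<in>F. hangs v \<phi>) then g v - interpolant (through_cell v) g v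
     else g v)"

lemma linear_residual: "linear residual"
proof (rule linearI)
  show "residual (f + g) = residual f + residual g" for f g
    by (rule ext) (simp add: residual_def interpolant_add)
  show "residual (c *\<^sub>R f) = c *\<^sub>R residual f" for c f
    by (rule ext) (simp add: residual_def interpolant_scaleR scaleR_fun_apply right_diff_distrib)
qed

text \<open>
  The system is square, and its homogeneous version has only the zero solution by the maximum
  principle.  No elimination order is needed: the conditions can depend on each other cyclically,
  as in a pinwheel of four cells around a fifth.
\<close>

lemma residual_onto:
  assumes "h \<in> supported_on V"
  obtains g where "g \<in> supported_on V" "residual g = h"
proof -
  obtain B where B: "finite B" "span B = supported_on V"
    by (rule supported_on_basis[OF finite_vertices])
  have kernel: "g = 0" if g: "g \<in> supported_on V" "residual g = 0" for g
  proof
    fix v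
    show "g v = 0 v"
    proof (cases "v \<in> V")
      case True
      have "g u = 0 \<or> (\<exists>\<phi>\<in>F. hangs u \<phi> \<and> g u = interpolant \<phi> g u)" if "u \<in> V" for u
      proof -
        have "residual g u = 0" using g(2) by simp
        show ?thesis
        proof (cases "u \<notin> frontier \<Omega> \<and> (\<exists>\<phi>\<in>F. hangs u \<phi>)")
          case True
          then obtain \<phi> where \<phi>: "\<phi> \<in> F" "hangs u \<phi>" by blast
          have "residual g u = g u - interpolant \<phi> g u"
            unfolding residual_def through_cell_eq[OF that \<phi>] using True that by simp
          with \<open>residual g u = 0\<close> have "g u = interpolant \<phi> g u" by simp
          then show ?thesis using \<phi> by auto
        next
          case False
          then have "g u = 0"
            using \<open>residual g u = 0\<close> that by (simp only: residual_def if_False if_True not_True_eq_False)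
          then show ?thesis by simp
        qed
      qed
      then have "g v = 0" by (rule zero_if_interpolated_where_nonzero[OF _ True])
      then show ?thesis by simp
    qed (use supported_onD[OF g(1)] in simp)
  qed
  have "inj_on residual (supported_on V)"
    unfolding linear_inj_on_iff_eq_0[OF linear_residual subspace_supported_on]
  proof (intro ballI impI)
    show "g = 0" if "g \<in> supported_on V" "residual g = 0" for g using that by (rule kernel)
  qed
  moreover have "residual g \<in> supported_on V" for g
    by (simp add: supported_on_def residual_def)
  then have "residual ` supported_on V \<subseteq> supported_on V" by blast
  ultimately have "residual ` supported_on V = supported_on V"
    using injective_endomorphism_surjective[OF linear_residual B(1)] unfolding B(2) by (simp only:)
  then have "h \<in> residual ` supported_on V" using assms by (simp only:)
  then show ?thesis using that by (elim imageE) simp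
qed

lemma compatible_extension:
  assumes h: "h \<in> supported_on (crossing_vertices F)"
  obtains g where "\<And>v. v \<in> crossing_vertices F \<Longrightarrow> g v = h v"
    "\<And>v. v \<in> V \<Longrightarrow> v \<in> frontier \<Omega> \<Longrightarrow> g v = 0"
    "\<And>v \<phi>. v \<in> V \<Longrightarrow> \<phi> \<in> F \<Longrightarrow> v \<in> \<phi> \<Longrightarrow> interpolant \<phi> g v = g v"
proof -
  have "h \<in> supported_on V" using h unfolding supported_on_def crossing_iff by blast
  then obtain g where g: "residual g = h" using residual_onto by metis
  have free: "g v = h v" if "v \<in> V" "v \<in> frontier \<Omega> \<or> (\<forall>\<phi>\<in>F. \<not> hangs v \<phi>)" for v
    unfolding g[symmetric] residual_def using that by auto
  have boundary: "g v = 0" if "v \<in> V" "v \<in> frontier \<Omega>" for v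
    using free[OF that(1)] that(2) supported_onD[OF h, of v] crossing_iff[of v] by simp
  have "interpolant \<phi> g v = g v" if v: "v \<in> V" "\<phi> \<in> F" "v \<in> \<phi>" for v \<phi>
  proof (cases "v \<in> frontier \<Omega>")
    case True
    then show ?thesis using interpolant_zero_on_boundary[OF v(2,3)] boundary v(1) by simp
  next
    case inner: False
    show ?thesis
    proof (cases "hangs v \<phi>")
      case True
      then have "h v = 0" using h v(2) unfolding supported_on_def crossing_iff by blast
      moreover have "residual g v = g v - interpolant \<phi> g v"
        unfolding residual_def through_cell_eq[OF v(1,2) True] using True inner v by auto
      ultimately show ?thesis using g by simp
    next
      case False
      then show ?thesis using vertex_in_cell[OF v(2,1,3)] interpolant_corner[OF cell[OF v(2)]] by blast
    qed
  qed
  moreover have "g v = h v" if "v \<in> crossing_vertices F" for v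
    using free that unfolding crossing_iff by blast
  ultimately show ?thesis using that boundary by blast
qed

section \<open>Gluing bilinear pieces\<close>

text \<open>
  Two cells meet in a segment or a point.  Its ends are corners of one of the two cells, so they are
  vertices and both interpolants agree with \<open>g\<close> there; both are affine along the segment.
\<close>

lemma interpolants_agree:
  assumes g: "\<And>v \<phi>. v \<in> V \<Longrightarrow> \<phi> \<in> F \<Longrightarrow> v \<in> \<phi> \<Longrightarrow> interpolant \<phi> g v = g v"
    and \<phi>: "\<phi> \<in> F" "p \<in> \<phi>" and \<psi>: "\<psi> \<in> F" "p \<in> \<psi>"
  shows "interpolant \<phi> g p = interpolant \<psi> g p"
proof (cases "\<phi> = \<psi>")
  case False
  obtain x y where p: "p = (x, y)" by fastforce
  note R = cell[OF \<phi>(1)] and S = cell[OF \<psi>(1)]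
  note ineq = rectangle_xmin_less[OF R] rectangle_ymin_less[OF R] rectangle_xmin_less[OF S] rectangle_ymin_less[OF S]
  have pR: "xmin \<phi> \<le> x" "x \<le> xmax \<phi>" "ymin \<phi> \<le> y" "y \<le> ymax \<phi>"
    and pS: "xmin \<psi> \<le> x" "x \<le> xmax \<psi>" "ymin \<psi> \<le> y" "y \<le> ymax \<psi>"
    using \<phi>(2) \<psi>(2) unfolding p mem_rectangle[OF R] mem_rectangle[OF S] by simp_all
  have agree: "interpolant \<phi> g v = interpolant \<psi> g v"
    if "v \<in> rectangle_corners \<phi> \<or> v \<in> rectangle_corners \<psi>" "v \<in> \<phi>" "v \<in> \<psi>" for v
    using that g \<phi>(1) \<psi>(1) vertex_iff by metis
  let ?a = "max (xmin \<phi>) (xmin \<psi>)" and ?b = "min (xmax \<phi>) (xmax \<psi>)"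
  let ?c = "max (ymin \<phi>) (ymin \<psi>)" and ?d = "min (ymax \<phi>) (ymax \<psi>)"
  have "x = xmax \<phi> \<and> x = xmin \<psi> \<or> x = xmax \<psi> \<and> x = xmin \<phi> \<or> y = ymax \<phi> \<and> y = ymin \<psi> \<or> y = ymax \<psi> \<and> y = ymin \<phi>"
    using cells_apart[OF \<phi>(1) \<psi>(1) False] pR pS by linarith
  then consider (vertical) "x = xmax \<phi> \<and> x = xmin \<psi> \<or> x = xmax \<psi> \<and> x = xmin \<phi>"
    | (horizontal) "y = ymax \<phi> \<and> y = ymin \<psi> \<or> y = ymax \<psi> \<and> y = ymin \<phi>"
    by blast
  then show ?thesis
  proof cases
    case vertical
    have "interpolant \<phi> g (x, ?c) = interpolant \<psi> g (x, ?c)"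
      using vertical ineq pR pS
      by (intro agree) (auto simp: mem_rectangle_corners[OF R] mem_rectangle_corners[OF S] mem_rectangle[OF R] mem_rectangle[OF S] max_def)
    moreover have "interpolant \<phi> g (x, ?d) = interpolant \<psi> g (x, ?d)"
      using vertical ineq pR pS
      by (intro agree) (auto simp: mem_rectangle_corners[OF R] mem_rectangle_corners[OF S] mem_rectangle[OF R] mem_rectangle[OF S] min_def)
    ultimately show ?thesis
      unfolding p by (rule interpolants_eq_between_y) (use pR pS in auto)
  next
    case horizontal
    have "interpolant \<phi> g (?a, y) = interpolant \<psi> g (?a, y)"
      using horizontal ineq pR pS
      by (intro agree) (auto simp: mem_rectangle_corners[OF R] mem_rectangle_corners[OF S] mem_rectangle[OF R] mem_rectangle[OF S] max_def)
    moreover have "interpolant \<phi> g (?b, y) = interpolant \<psi> g (?b, y)"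
      using horizontal ineq pR pS
      by (intro agree) (auto simp: mem_rectangle_corners[OF R] mem_rectangle_corners[OF S] mem_rectangle[OF R] mem_rectangle[OF S] min_def)
    ultimately show ?thesis
      unfolding p by (rule interpolants_eq_between_x) (use pR pS in auto)
  qed
qed simp

abbreviation "spline \<equiv> hom_spline_space 1 1 0 0 F"

lemma spline_space_iff:
  "f \<in> spline \<longleftrightarrow> continuous_on UNIV f \<and> (\<forall>\<phi>\<in>F. bidegree_poly_on 1 1 \<phi> f) \<and> (\<forall>p. p \<notin> \<Omega> \<longrightarrow> f p = 0)"
  by (simp add: hom_spline_space_def C_order_0_0)

text \<open>
  The interpolants on the finitely many closed cells and the zero function on the closed complement
  of the interior of the region agree wherever two of these sets meet.
\<close>

lemma spline_from_vertex_values: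
  assumes boundary: "\<And>v. v \<in> V \<Longrightarrow> v \<in> frontier \<Omega> \<Longrightarrow> g v = 0"
    and g: "\<And>v \<phi>. v \<in> V \<Longrightarrow> \<phi> \<in> F \<Longrightarrow> v \<in> \<phi> \<Longrightarrow> interpolant \<phi> g v = g v"
  obtains f where "f \<in> spline" "\<And>v. v \<in> V \<Longrightarrow> f v = g v"
proof -
  \<comment> \<open>the choice of the cell is immaterial by \<open>interpolants_agree\<close>\<close>
  define f where "f p = (if p \<in> \<Omega> then interpolant (SOME \<phi>. \<phi> \<in> F \<and> p \<in> \<phi>) g p else 0)" for p
  have f_cell: "f p = interpolant \<phi> g p" if "\<phi> \<in> F" "p \<in> \<phi>" for p \<phi>
  proof -
    define \<psi> where "\<psi> = (SOME \<phi>. \<phi> \<in> F \<and> p \<in> \<phi>)"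
    have "\<exists>\<phi>. \<phi> \<in> F \<and> p \<in> \<phi>" using that by blast
    from someI_ex[OF this] have \<psi>: "\<psi> \<in> F" "p \<in> \<psi>" unfolding \<psi>_def by simp_all
    have "p \<in> \<Omega>" using that unfolding mesh_region_def by blast
    then have "f p = interpolant \<psi> g p" unfolding f_def \<psi>_def by simp
    also have "\<dots> = interpolant \<phi> g p"
      using g \<psi> that by (rule interpolants_agree)
    finally show ?thesis .
  qed
  have f_outside: "f p = 0" if "p \<in> - interior \<Omega>" for p
  proof (cases "p \<in> \<Omega>")
    case True
    then obtain \<phi> where \<phi>: "\<phi> \<in> F" "p \<in> \<phi>" unfolding mesh_region_def by blast
    have "p \<in> frontier \<Omega>" using True that by (simp add: mem_frontier_rectangle region)
    then have "interpolant \<phi> g p = 0" by (rule interpolant_zero_on_boundary[OF \<phi> _ boundary])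
    then show ?thesis using f_cell[OF \<phi>] by (simp only:)
  qed (simp add: f_def)
  have cont_cell: "continuous_on \<phi> f" if "\<phi> \<in> F" for \<phi>
    by (rule continuous_on_eq[OF continuous_on_interpolant]) (rule f_cell[OF that, symmetric])
  have "continuous_on (\<Union>\<phi>\<in>F. \<phi>) f"
    by (rule continuous_on_closed_Union[OF finite_cells]) (erule closed_rectangle[OF cell], erule cont_cell)
  then have "continuous_on \<Omega> f" unfolding mesh_region_def by simp
  moreover have "continuous_on (- interior \<Omega>) f"
    by (rule continuous_on_eq[OF continuous_on_const]) (rule f_outside[symmetric])
  ultimately have "continuous_on (\<Omega> \<union> - interior \<Omega>) f"
    using closed_rectangle[OF region] by (intro continuous_on_closed_Un closed_Compl open_interior)
  moreover have "\<Omega> \<union> - interior \<Omega> = UNIV" using interior_subset[of \<Omega>] by blast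
  ultimately have cont: "continuous_on UNIV f" by (simp only:)
  have poly: "bidegree_poly_on 1 1 \<phi> f" if "\<phi> \<in> F" for \<phi>
  proof -
    obtain c where c: "\<forall>x y. (x, y) \<in> \<phi> \<longrightarrow> interpolant \<phi> g (x, y) = (\<Sum>i\<le>1. \<Sum>j\<le>1. c i j * x ^ i * y ^ j)"
      using interpolant_poly[of \<phi> \<phi> g] unfolding bidegree_poly_on_def by (elim exE)
    show ?thesis
      unfolding bidegree_poly_on_def
    proof (intro exI allI impI)
      fix x y assume xy: "(x, y) \<in> \<phi>"
      show "f (x, y) = (\<Sum>i\<le>1. \<Sum>j\<le>1. c i j * x ^ i * y ^ j)"
        using f_cell[OF that xy] c[rule_format, OF xy] by (rule trans)
    qed
  qed
  have zero: "f p = 0" if "p \<notin> \<Omega>" for p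
    using that by (simp add: f_def)
  have "f \<in> spline"
    unfolding spline_space_iff by (intro conjI ballI allI impI) (fact cont, erule poly, erule zero)
  moreover have "f v = g v" if v: "v \<in> V" for v
  proof -
    obtain \<phi> where "\<phi> \<in> F" "v \<in> rectangle_corners \<phi>" using v vertex_iff by blast
    then have \<phi>: "\<phi> \<in> F" "v \<in> \<phi>" using rectangle_corners_subset[OF cell] by blast+
    show ?thesis using f_cell[OF \<phi>] g[OF v \<phi>] by (simp only:)
  qed
  ultimately show ?thesis by (rule that)
qed

section \<open>Splines are determined by their values at crossing vertices\<close>

lemma spline_zero_on_boundary:
  assumes f: "f \<in> spline" and p: "p \<in> frontier \<Omega>"
  shows "f p = 0"
proof -
  have "continuous_on (closure (- \<Omega>)) f"
    using f continuous_on_subset unfolding spline_space_iff by blast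
  moreover have "p \<in> closure (- \<Omega>)" using p by (simp add: frontier_closures)
  ultimately show ?thesis
    using continuous_constant_on_closure[of "- \<Omega>" f 0 p] f unfolding spline_space_iff by auto
qed

text \<open>
  A spline satisfies the interpolation condition at every hanging vertex, so the maximum principle
  forces its values at all vertices, and then on all cells, to vanish.
\<close>

lemma spline_zero_if_zero_at_crossings:
  assumes f: "f \<in> spline" and zero: "\<And>v. v \<in> crossing_vertices F \<Longrightarrow> f v = 0"
  shows "f = 0"
proof
  have interp: "f p = interpolant \<phi> f p" if "\<phi> \<in> F" "p \<in> \<phi>" for \<phi> p
    using interpolant_reproduces[OF cell] f that unfolding spline_space_iff by blast
  have vertex: "f v = 0" if "v \<in> V" for v
  proof (rule zero_if_interpolated_where_nonzero[OF _ that])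
    fix u assume u: "u \<in> V"
    show "f u = 0 \<or> (\<exists>\<phi>\<in>F. hangs u \<phi> \<and> f u = interpolant \<phi> f u)"
    proof (cases "u \<in> frontier \<Omega> \<or> u \<in> crossing_vertices F")
      case True
      then show ?thesis using spline_zero_on_boundary[OF f] zero by blast
    next
      case False
      then obtain \<phi> where \<phi>: "\<phi> \<in> F" "hangs u \<phi>" using u crossing_iff by blast
      then have "u \<in> \<phi>" by (simp add: hangs_def mem_frontier_rectangle cell)
      then show ?thesis using interp \<phi> by blast
    qed
  qed
  fix p
  show "f p = 0 p"
  proof (cases "p \<in> \<Omega>")
    case True
    then obtain \<phi> where \<phi>: "\<phi> \<in> F" "p \<in> \<phi>" unfolding mesh_region_def by blast
    have "f p = interpolant \<phi> 0 p"
      unfolding interp[OF \<phi>] using vertex vertex_iff \<phi>(1) by (intro interpolant_cong[OF cell]) auto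
    then show ?thesis by (simp add: interpolant_def)
  next
    case False
    then show ?thesis using f unfolding spline_space_iff by (metis zero_fun_apply)
  qed
qed

section \<open>The dimension\<close>

definition crossing_values :: "(real \<times> real \<Rightarrow> real) \<Rightarrow> real \<times> real \<Rightarrow> real"
  where "crossing_values f v = (if v \<in> crossing_vertices F then f v else 0)"

lemma linear_crossing_values: "linear crossing_values"
  by (rule linearI; rule ext) (simp_all add: crossing_values_def scaleR_fun_apply)

lemma inj_on_crossing_values: "inj_on crossing_values spline"
  unfolding linear_inj_on_iff_eq_0[OF linear_crossing_values subspace_hom_spline_space]
proof (intro ballI impI)
  fix f assume "f \<in> spline" "crossing_values f = 0"
  then show "f = 0"
    using spline_zero_if_zero_at_crossings[of f] by (metis crossing_values_def zero_fun_apply)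
qed

lemma crossing_values_onto: "crossing_values ` spline = supported_on (crossing_vertices F)"
proof (intro subset_antisym subsetI)
  fix h assume h: "h \<in> supported_on (crossing_vertices F)"
  obtain g where g: "\<And>v. v \<in> crossing_vertices F \<Longrightarrow> g v = h v"
    "\<And>v. v \<in> V \<Longrightarrow> v \<in> frontier \<Omega> \<Longrightarrow> g v = 0"
    "\<And>v \<phi>. v \<in> V \<Longrightarrow> \<phi> \<in> F \<Longrightarrow> v \<in> \<phi> \<Longrightarrow> interpolant \<phi> g v = g v"
    using compatible_extension[OF h] by blast
  obtain f where f: "f \<in> spline" "\<And>v. v \<in> V \<Longrightarrow> f v = g v"
    using spline_from_vertex_values[OF g(2,3)] by blast
  have "crossing_values f v = h v" for v
    using f(2)[of v] g(1)[of v] supported_onD[OF h, of v] crossing_iff[of v]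
    by (simp add: crossing_values_def)
  then have "crossing_values f = h" by (rule ext)
  then show "h \<in> crossing_values ` spline" using f(1) by blast
qed (auto simp: crossing_values_def supported_on_def)

end

theorem theorem3p4:
  fixes F :: mesh
  assumes "regular_T_mesh F"
  shows "(\<exists>B. finite B \<and> span B = hom_spline_space 1 1 0 0 F) \<and>
    dim (hom_spline_space 1 1 0 0 F) = card (crossing_vertices F)"
proof -
  interpret regular_mesh F by unfold_locales (rule assms)
  have "finite (crossing_vertices F)"
    by (rule finite_subset[OF _ finite_vertices]) (auto simp: crossing_iff)
  then obtain B where B: "finite B" "independent B" "span B = supported_on (crossing_vertices F)"
      "card B = card (crossing_vertices F)"
    by (rule supported_on_basis)
  show ?thesis
    using linear_iso_pulls_back_basis[OF linear_crossing_values subspace_hom_spline_space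
        inj_on_crossing_values B(1,2)] B(3,4) crossing_values_onto
    by simp
qed

end
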